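(* Let $s_i$ ($1\le i\le N_0$), $t_j$ ($1\le j\le N_1$) be solutions of the $\mathcal E_2$ Bethe ansatz equations $$p_0^\vee\,\frac{s_i-v}{s_i-(q_2^\vee)^{-1}v}\prod_{j=1}^{N_0}\frac{q_2^\vee s_i-s_j}{(q_2^\vee)^{-1}s_i-s_j}\prod_{k=1}^{N_1}\frac{(q_1^\vee s_i-t_k)(q_3^\vee s_i-t_k)}{((q_1^\vee)^{-1}s_i-t_k)((q_3^\vee)^{-1}s_i-t_k)}=-1\qquad(1\le i\le N_0),$$ $$p_1^\vee\prod_{j=1}^{N_1}\frac{q_2^\vee t_i-t_j}{(q_2^\vee)^{-1}t_i-t_j}\prod_{k=1}^{N_0}\frac{(q_1^\vee t_i-s_k)(q_3^\vee t_i-s_k)}{((q_1^\vee)^{-1}t_i-s_k)((q_3^\vee)^{-1}t_i-s_k)}=-1\qquad(1\le i\le N_1),$$ with parameters in the Intermediate Long Wave (ILW) limit $\epsilon\to0$: $$q_1^\vee=e^{-\tau}(1+\epsilon+o(\epsilon)),\quad q_2^\vee=1-\epsilon+o(\epsilon),\quad q_3^\vee=e^\tau,\quad p^\vee=1+r\epsilon+o(\epsilon),\quad p_1^\vee=1-\frac{\hat\pi}{2}\epsilon+o(\epsilon),\quad v,\tau\ \text{fixed}.$$ Let their ILW limits be $\lim_{\epsilon\to0}s_i=\tilde s_i$ and $\lim_{\epsilon\to0}t_j=\tilde t_j$, $i=1,\dots,N_0$, $j=1,\dots,N_1$. Then the limits $\tilde s_i,\tilde t_j$ satisfy the system of equations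 $$\frac{r-\hat\pi-2}{\tilde s_i}+\frac1{\tilde s_i-v}-\sum_{k=1,\,k\ne i}^{N_0}\frac2{\tilde s_i-\tilde s_k}+\sum_{k=1}^{N_1}\Bigl(\frac1{\tilde s_i-e^\tau\tilde t_k}+\frac1{\tilde s_i-e^{-\tau}\tilde t_k}\Bigr)=0,\qquad i=1,\dots,N_0,$$ $$\frac{\hat\pi-1}{\tilde t_j}-\sum_{k=1,\,k\ne j}^{N_1}\frac2{\tilde t_j-\tilde t_k}+\sum_{k=1}^{N_0}\Bigl(\frac1{\tilde t_j-e^\tau\tilde s_k}+\frac1{\tilde t_j-e^{-\tau}\tilde s_k}\Bigr)=0,\qquad j=1,\dots,N_1.$$
   Context: The parameters satisfy $q_1^\vee q_2^\vee q_3^\vee=1$; $r$ and $\hat\pi$ are fixed. The equations are the Bethe ansatz equations for the quantum toroidal $\mathfrak{gl}_2$ algebra $\mathcal E_2(q_1^\vee,q_2^\vee,q_3^\vee)$ acting on a single Fock module $\mathcal F_0(v)$, and $p^\vee=p_0^\vee p_1^\vee$.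
   Formalization: The expansion of p_1^∨ is taken as 1+π̂ε+o(ε) instead of the printed 1−(π̂/2)ε+o(ε), which is incompatible with the stated coefficients r−π̂−2 and π̂−1; all denominators of the limiting system are assumed nonzero. *)

theory Defs
  imports "HOL-Analysis.Analysis" "HOL-Library.Landau_Symbols"
begin

text \<open>
  The Bethe ansatz equations of the quantum toroidal \<open>gl\<^sub>2\<close> algebra
  with parameters \<open>q1, q2, q3\<close> on the Fock module \<open>F\<^sub>0(v)\<close>.
  The diagonal factor of the self-interaction product is included, as in the usual form
  with right-hand side \<open>-1\<close>.  Since \<open>x / 0 = 0\<close> in HOL and
  the right-hand side is nonzero, a family satisfying the equations automatically has nonzero
  denominators, so no separate condition is needed for the fractions to make sense.
\<close>

definition toroidal_gl2_bethe ::
  "complex \<Rightarrow> complex \<Rightarrow> complex \<Rightarrow> complex \<Rightarrow> complex \<Rightarrow> complex \<Rightarrow> nat \<Rightarrow> nat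
    \<Rightarrow> (nat \<Rightarrow> complex) \<Rightarrow> (nat \<Rightarrow> complex) \<Rightarrow> bool" where
  "toroidal_gl2_bethe q1 q2 q3 p0 p1 v N0 N1 s t \<longleftrightarrow>
    (\<forall>i\<in>{1..N0}.
       p0 * ((s i - v) / (s i - inverse q2 * v))
         * (\<Prod>j=1..N0. (q2 * s i - s j) / (inverse q2 * s i - s j))
         * (\<Prod>k=1..N1. ((q1 * s i - t k) * (q3 * s i - t k)) /
              ((inverse q1 * s i - t k) * (inverse q3 * s i - t k))) = -1) \<and>
    (\<forall>i\<in>{1..N1}.
       p1 * (\<Prod>j=1..N1. (q2 * t i - t j) / (inverse q2 * t i - t j))
          * (\<Prod>k=1..N0. ((q1 * t i - s k) * (q3 * t i - s k)) /
              ((inverse q1 * t i - s k) * (inverse q3 * t i - s k))) = -1)"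

text \<open>
  The intermediate long wave limit, for parameters depending on \<open>\<epsilon> \<in> E\<close> as
  \<open>\<epsilon> \<rightarrow> 0\<close>.  The set \<open>E\<close> is any set of complex numbers accumulating at \<open>0\<close>, so that a real
  one-sided limit, a limit along a sequence, and a limit in a punctured complex neighbourhood or
  in a sector of it (where branches of solutions of the Bethe equations are single-valued) are
  all covered.  The parameter \<open>p\<close> is the product \<open>p0 p1\<close>.

  The expansion \<open>p1 = 1 + \<pi>' \<epsilon> + o(\<epsilon>)\<close> departs from the source, which prints
  \<open>p1 = 1 - (\<pi>'/2) \<epsilon> + o(\<epsilon>)\<close>.  The printed normalization is incompatible with the
  \<open>1 / s\<close> and \<open>1 / t\<close> coefficients \<open>r - \<pi>' - 2\<close> and \<open>\<pi>' - 1\<close> of the limiting system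
  (it produces \<open>r + \<pi>'/2 - 2\<close> and \<open>-\<pi>'/2 - 1\<close>); the two versions differ by the
  substitution of \<open>-\<pi>'/2\<close> for \<open>\<pi>'\<close>.
\<close>

definition ILW_parameters ::
  "complex set \<Rightarrow> (complex \<Rightarrow> complex) \<Rightarrow> (complex \<Rightarrow> complex) \<Rightarrow> (complex \<Rightarrow> complex)
    \<Rightarrow> (complex \<Rightarrow> complex) \<Rightarrow> (complex \<Rightarrow> complex) \<Rightarrow> complex \<Rightarrow> complex \<Rightarrow> complex \<Rightarrow> bool" where
  "ILW_parameters E q1 q2 q3 p0 p1 \<tau> r \<pi>' \<longleftrightarrow>
    (\<forall>\<^sub>F \<epsilon> in at 0 within E. q1 \<epsilon> * q2 \<epsilon> * q3 \<epsilon> = 1) \<and>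
    (\<lambda>\<epsilon>. q1 \<epsilon> - exp (- \<tau>) * (1 + \<epsilon>)) \<in> o[at 0 within E](\<lambda>\<epsilon>. \<epsilon>) \<and>
    (\<lambda>\<epsilon>. q2 \<epsilon> - (1 - \<epsilon>)) \<in> o[at 0 within E](\<lambda>\<epsilon>. \<epsilon>) \<and>
    (\<forall>\<^sub>F \<epsilon> in at 0 within E. q3 \<epsilon> = exp \<tau>) \<and>
    (\<lambda>\<epsilon>. p0 \<epsilon> * p1 \<epsilon> - (1 + r * \<epsilon>)) \<in> o[at 0 within E](\<lambda>\<epsilon>. \<epsilon>) \<and>
    (\<lambda>\<epsilon>. p1 \<epsilon> - (1 + \<pi>' * \<epsilon>)) \<in> o[at 0 within E](\<lambda>\<epsilon>. \<epsilon>)"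

text \<open>
  All denominators of the limiting system are nonzero.  Those of the \<open>t\<close>-equations coupling
  \<open>t\<close> to \<open>s\<close> vanish exactly when those of the \<open>s\<close>-equations do.
\<close>

definition ILW_nondegenerate ::
  "complex \<Rightarrow> complex \<Rightarrow> nat \<Rightarrow> nat \<Rightarrow> (nat \<Rightarrow> complex) \<Rightarrow> (nat \<Rightarrow> complex) \<Rightarrow> bool" where
  "ILW_nondegenerate \<tau> v N0 N1 s t \<longleftrightarrow>
    (\<forall>i\<in>{1..N0}. s i \<noteq> 0 \<and> s i \<noteq> v) \<and> (\<forall>j\<in>{1..N1}. t j \<noteq> 0) \<and>
    inj_on s {1..N0} \<and> inj_on t {1..N1} \<and>
    (\<forall>i\<in>{1..N0}. \<forall>k\<in>{1..N1}. s i \<noteq> exp \<tau> * t k \<and> s i \<noteq> exp (- \<tau>) * t k)"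

definition ILW_bethe ::
  "complex \<Rightarrow> complex \<Rightarrow> complex \<Rightarrow> complex \<Rightarrow> nat \<Rightarrow> nat
    \<Rightarrow> (nat \<Rightarrow> complex) \<Rightarrow> (nat \<Rightarrow> complex) \<Rightarrow> bool" where
  "ILW_bethe \<tau> r \<pi>' v N0 N1 s t \<longleftrightarrow>
    (\<forall>i\<in>{1..N0}.
       (r - \<pi>' - 2) / s i + 1 / (s i - v)
         - (\<Sum>k\<in>{1..N0} - {i}. 2 / (s i - s k))
         + (\<Sum>k=1..N1. 1 / (s i - exp \<tau> * t k) + 1 / (s i - exp (- \<tau>) * t k)) = 0) \<and>
    (\<forall>j\<in>{1..N1}.
       (\<pi>' - 1) / t j
         - (\<Sum>k\<in>{1..N1} - {j}. 2 / (t j - t k))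
         + (\<Sum>k=1..N0. 1 / (t j - exp \<tau> * s k) + 1 / (t j - exp (- \<tau>) * s k)) = 0)"

end

theory Submission
  imports Defs
begin

text \<open>
  Each Bethe equation says that a product of factors equals \<open>1\<close>, once the diagonal factor
  \<open>(q2 x - x) / (inverse q2 x - x) = - q2\<close> has been cancelled against the sign on the right-hand
  side.  In the limit every remaining factor has the form \<open>1 + c \<epsilon> + o(\<epsilon>)\<close>, so the
  first-order coefficients \<open>c\<close>, which add up under multiplication, must sum to \<open>0\<close>; dividing that
  sum by the limit of the unknown gives the ILW equation.

  The unknowns are only known to converge, with no control on the rate.  This suffices because each
  factor is a ratio \<open>(a x - y) / (b x - y)\<close> in which numerator and denominator differ by
  \<open>(a - b) x\<close>: the difference \<open>a - b\<close> of the parameters carries the whole order \<open>\<epsilon>\<close>, while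
  \<open>x\<close> and \<open>y\<close> enter the coefficient through their limits alone (\<open>unit_expansion_ratio\<close>).
  The pairing that achieves this for the interaction of the two species is \<open>q1\<close> with
  \<open>inverse q3\<close> and \<open>q3\<close> with \<open>inverse q1\<close>.

  Both families of equations have the same shape apart from a prefactor, which is \<open>p1\<close> for \<open>t\<close>
  and \<open>p0 (s - v) / (s - v / q2)\<close> for \<open>s\<close>, so one limit computation
  (\<open>bethe_equation_limit\<close>) serves both.
\<close>

text \<open>
  This is \<open>f \<epsilon> = 1 + c \<epsilon> + o(\<epsilon>)\<close>.  It is not phrased as a derivative, because the Bethe
  data are given only near \<open>0\<close>: nothing is assumed about \<open>f 0\<close>.
\<close>

definition unit_expansion ::
  "'a::real_normed_field filter \<Rightarrow> ('a \<Rightarrow> 'a) \<Rightarrow> 'a \<Rightarrow> bool" where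
  "unit_expansion F f c \<longleftrightarrow> ((\<lambda>\<epsilon>. (f \<epsilon> - 1) / \<epsilon>) \<longlongrightarrow> c) F"

lemma tendsto_difference_quotient_of_smallo:
  fixes f :: "'a::real_normed_field \<Rightarrow> 'a"
  assumes "(\<lambda>\<epsilon>. f \<epsilon> - (a + c * \<epsilon>)) \<in> o[at 0 within E](\<lambda>\<epsilon>. \<epsilon>)"
  shows "((\<lambda>\<epsilon>. (f \<epsilon> - a) / \<epsilon>) \<longlongrightarrow> c) (at 0 within E)"
proof -
  have "((\<lambda>\<epsilon>. (f \<epsilon> - (a + c * \<epsilon>)) / \<epsilon> + c) \<longlongrightarrow> 0 + c) (at 0 within E)"
    by (intro tendsto_intros smalloD_tendsto[OF assms])
  moreover have "\<forall>\<^sub>F \<epsilon> in at 0 within E. (f \<epsilon> - (a + c * \<epsilon>)) / \<epsilon> + c = (f \<epsilon> - a) / \<epsilon>"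
    using eventually_neq_at_within[of 0 0 E] by eventually_elim (simp add: field_simps)
  ultimately show ?thesis
    by (simp add: tendsto_cong)
qed

lemma tendsto_of_difference_quotient:
  fixes f :: "'a::real_normed_field \<Rightarrow> 'a"
  assumes "((\<lambda>\<epsilon>. (f \<epsilon> - a) / \<epsilon>) \<longlongrightarrow> c) (at 0 within E)"
  shows "(f \<longlongrightarrow> a) (at 0 within E)"
proof -
  have "((\<lambda>\<epsilon>. (f \<epsilon> - a) / \<epsilon> * \<epsilon> + a) \<longlongrightarrow> c * 0 + a) (at 0 within E)"
    by (intro tendsto_intros assms)
  moreover have "\<forall>\<^sub>F \<epsilon> in at 0 within E. (f \<epsilon> - a) / \<epsilon> * \<epsilon> + a = f \<epsilon>"
    using eventually_neq_at_within[of 0 0 E] by eventually_elim simp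
  ultimately show ?thesis
    by (simp add: tendsto_cong)
qed

lemma difference_quotient_inverse:
  fixes f :: "'a::real_normed_field \<Rightarrow> 'a"
  assumes f: "((\<lambda>\<epsilon>. (f \<epsilon> - a) / \<epsilon>) \<longlongrightarrow> c) (at 0 within E)" and "a \<noteq> 0"
  shows "((\<lambda>\<epsilon>. (inverse (f \<epsilon>) - inverse a) / \<epsilon>) \<longlongrightarrow> - c / a\<^sup>2) (at 0 within E)"
proof -
  have lim: "(f \<longlongrightarrow> a) (at 0 within E)"
    using f by (rule tendsto_of_difference_quotient)
  have "((\<lambda>\<epsilon>. - ((f \<epsilon> - a) / \<epsilon>) / (f \<epsilon> * a)) \<longlongrightarrow> - c / (a * a)) (at 0 within E)"
    using \<open>a \<noteq> 0\<close> by (intro tendsto_intros f lim) simp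
  moreover have "\<forall>\<^sub>F \<epsilon> in at 0 within E.
      - ((f \<epsilon> - a) / \<epsilon>) / (f \<epsilon> * a) = (inverse (f \<epsilon>) - inverse a) / \<epsilon>"
    using tendsto_imp_eventually_ne[OF lim \<open>a \<noteq> 0\<close>] eventually_neq_at_within[of 0 0 E]
    by eventually_elim (use \<open>a \<noteq> 0\<close> in \<open>simp add: field_simps\<close>)
  ultimately show ?thesis
    by (simp add: tendsto_cong power2_eq_square)
qed

lemma unit_expansion_mult:
  assumes f: "unit_expansion (at 0 within E) f c" and g: "unit_expansion (at 0 within E) g d"
  shows "unit_expansion (at 0 within E) (\<lambda>\<epsilon>. f \<epsilon> * g \<epsilon>) (c + d)"
proof -
  have "((\<lambda>\<epsilon>. (f \<epsilon> - 1) / \<epsilon> * g \<epsilon> + (g \<epsilon> - 1) / \<epsilon>) \<longlongrightarrow> c * 1 + d) (at 0 within E)"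
    using f g tendsto_of_difference_quotient[of g 1 d E] unfolding unit_expansion_def
    by (intro tendsto_intros) auto
  moreover have "(\<lambda>\<epsilon>. (f \<epsilon> - 1) / \<epsilon> * g \<epsilon> + (g \<epsilon> - 1) / \<epsilon>) = (\<lambda>\<epsilon>. (f \<epsilon> * g \<epsilon> - 1) / \<epsilon>)"
    by (simp add: fun_eq_iff add_divide_distrib [symmetric] algebra_simps)
  ultimately show ?thesis
    by (simp add: unit_expansion_def)
qed

lemma unit_expansion_prod:
  assumes "\<And>i. i \<in> A \<Longrightarrow> unit_expansion (at 0 within E) (f i) (c i)"
  shows "unit_expansion (at 0 within E) (\<lambda>\<epsilon>. \<Prod>i\<in>A. f i \<epsilon>) (\<Sum>i\<in>A. c i)"
  using assms
proof (induction A rule: infinite_finite_induct)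
  case (insert i A)
  then show ?case
    using unit_expansion_mult[of E "f i" "c i"] by simp
qed (simp_all add: unit_expansion_def)

text \<open>
  A function can have only one first-order coefficient, and the constant \<open>1\<close> has
  coefficient \<open>0\<close>.
\<close>

lemma unit_expansion_eq_one:
  assumes "unit_expansion F f c" and "\<forall>\<^sub>F \<epsilon> in F. f \<epsilon> = 1" and "F \<noteq> bot"
  shows "c = 0"
proof -
  have "((\<lambda>\<epsilon>. (f \<epsilon> - 1) / \<epsilon>) \<longlongrightarrow> 0) F"
    by (rule tendsto_eventually) (use assms(2) in \<open>eventually_elim, simp\<close>)
  with assms show ?thesis
    unfolding unit_expansion_def using tendsto_unique by blast
qed

text \<open>
  Numerator and denominator differ by \<open>(a - b) x\<close>, so the rate at which \<open>x\<close> and \<open>y\<close>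
  approach their limits does not affect the first order.
\<close>

lemma unit_expansion_ratio:
  fixes a b x y :: "'a::real_normed_field \<Rightarrow> 'a"
  assumes ab: "((\<lambda>\<epsilon>. (a \<epsilon> - b \<epsilon>) / \<epsilon>) \<longlongrightarrow> d) F"
    and b: "(b \<longlongrightarrow> B) F" and x: "(x \<longlongrightarrow> X) F" and y: "(y \<longlongrightarrow> Y) F"
    and ne: "B * X \<noteq> Y"
  shows "unit_expansion F (\<lambda>\<epsilon>. (a \<epsilon> * x \<epsilon> - y \<epsilon>) / (b \<epsilon> * x \<epsilon> - y \<epsilon>)) (d * X / (B * X - Y))"
proof -
  have den: "((\<lambda>\<epsilon>. b \<epsilon> * x \<epsilon> - y \<epsilon>) \<longlongrightarrow> B * X - Y) F"
    by (intro tendsto_intros b x y)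
  have "((\<lambda>\<epsilon>. (a \<epsilon> - b \<epsilon>) / \<epsilon> * x \<epsilon> / (b \<epsilon> * x \<epsilon> - y \<epsilon>)) \<longlongrightarrow> d * X / (B * X - Y)) F"
    using ne by (intro tendsto_intros ab x den) simp
  moreover have "\<forall>\<^sub>F \<epsilon> in F. (a \<epsilon> - b \<epsilon>) / \<epsilon> * x \<epsilon> / (b \<epsilon> * x \<epsilon> - y \<epsilon>) =
      ((a \<epsilon> * x \<epsilon> - y \<epsilon>) / (b \<epsilon> * x \<epsilon> - y \<epsilon>) - 1) / \<epsilon>"
  proof -
    have "\<forall>\<^sub>F \<epsilon> in F. b \<epsilon> * x \<epsilon> - y \<epsilon> \<noteq> 0"
      by (rule tendsto_imp_eventually_ne[OF den]) (use ne in simp)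
    then show ?thesis
    proof eventually_elim
      case (elim \<epsilon>)
      then have "(a \<epsilon> * x \<epsilon> - y \<epsilon>) / (b \<epsilon> * x \<epsilon> - y \<epsilon>) - 1 =
          (a \<epsilon> - b \<epsilon>) * x \<epsilon> / (b \<epsilon> * x \<epsilon> - y \<epsilon>)"
        by (simp add: divide_simps left_diff_distrib)
      then show ?case
        by (simp add: mult.commute)
    qed
  qed
  ultimately show ?thesis
    unfolding unit_expansion_def by (simp add: tendsto_cong)
qed

text \<open>
  The limit of one Bethe equation, for a species \<open>x\<close> interacting with itself and with a second
  species \<open>y\<close>.  The prefactor contributes its coefficient \<open>c\<close> and the diagonal factor contributes
  \<open>- 1\<close>; all interaction coefficients are multiples of \<open>X i\<close>, so dividing by \<open>X i\<close> leaves
  the factor \<open>1 / X i\<close> on \<open>c - 1\<close> alone.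
\<close>

lemma bethe_equation_limit:
  fixes q1 q2 q3 P :: "complex \<Rightarrow> complex" and x y :: "nat \<Rightarrow> complex \<Rightarrow> complex"
  assumes "0 islimpt E"
    and q1: "((\<lambda>\<epsilon>. (q1 \<epsilon> - exp (- \<tau>)) / \<epsilon>) \<longlongrightarrow> exp (- \<tau>)) (at 0 within E)"
    and q2: "((\<lambda>\<epsilon>. (q2 \<epsilon> - 1) / \<epsilon>) \<longlongrightarrow> - 1) (at 0 within E)"
    and q3: "\<forall>\<^sub>F \<epsilon> in at 0 within E. q3 \<epsilon> = exp \<tau>"
    and P: "unit_expansion (at 0 within E) P c"
    and x: "\<And>j. j \<in> {1..N} \<Longrightarrow> (x j \<longlongrightarrow> X j) (at 0 within E)"
    and y: "\<And>k. k \<in> {1..M} \<Longrightarrow> (y k \<longlongrightarrow> Y k) (at 0 within E)"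
    and i: "i \<in> {1..N}" and nz: "X i \<noteq> 0" and inj: "inj_on X {1..N}"
    and XY: "\<And>k. k \<in> {1..M} \<Longrightarrow> X i \<noteq> exp \<tau> * Y k \<and> X i \<noteq> exp (- \<tau>) * Y k"
    and eq: "\<forall>\<^sub>F \<epsilon> in at 0 within E.
        P \<epsilon> * (\<Prod>j=1..N. (q2 \<epsilon> * x i \<epsilon> - x j \<epsilon>) / (inverse (q2 \<epsilon>) * x i \<epsilon> - x j \<epsilon>))
          * (\<Prod>k=1..M. ((q1 \<epsilon> * x i \<epsilon> - y k \<epsilon>) * (q3 \<epsilon> * x i \<epsilon> - y k \<epsilon>)) /
              ((inverse (q1 \<epsilon>) * x i \<epsilon> - y k \<epsilon>) * (inverse (q3 \<epsilon>) * x i \<epsilon> - y k \<epsilon>))) = -1"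
  shows "(c - 1) / X i - (\<Sum>j\<in>{1..N} - {i}. 2 / (X i - X j))
      + (\<Sum>k=1..M. 1 / (X i - exp \<tau> * Y k) + 1 / (X i - exp (- \<tau>) * Y k)) = 0"
proof -
  let ?F = "at 0 within E :: complex filter"
  have q1i: "((\<lambda>\<epsilon>. (inverse (q1 \<epsilon>) - exp \<tau>) / \<epsilon>) \<longlongrightarrow> - exp \<tau>) ?F"
    using difference_quotient_inverse[OF q1] by (simp add: exp_minus power2_eq_square field_simps)
  have q2i: "((\<lambda>\<epsilon>. (inverse (q2 \<epsilon>) - 1) / \<epsilon>) \<longlongrightarrow> 1) ?F"
    using difference_quotient_inverse[OF q2] by simp

  have q22: "((\<lambda>\<epsilon>. (q2 \<epsilon> - inverse (q2 \<epsilon>)) / \<epsilon>) \<longlongrightarrow> - 2) ?F"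
    using tendsto_diff[OF q2 q2i] by (simp add: diff_divide_distrib)
  have q13: "((\<lambda>\<epsilon>. (q1 \<epsilon> - inverse (q3 \<epsilon>)) / \<epsilon>) \<longlongrightarrow> exp (- \<tau>)) ?F"
    using q1 by (rule Lim_transform_eventually) (use q3 in \<open>eventually_elim, simp add: exp_minus\<close>)
  have q31: "((\<lambda>\<epsilon>. (q3 \<epsilon> - inverse (q1 \<epsilon>)) / \<epsilon>) \<longlongrightarrow> exp \<tau>) ?F"
  proof -
    have "((\<lambda>\<epsilon>. - ((inverse (q1 \<epsilon>) - exp \<tau>) / \<epsilon>)) \<longlongrightarrow> exp \<tau>) ?F"
      using tendsto_minus[OF q1i] by simp
    then show ?thesis
      by (rule Lim_transform_eventually)
        (use q3 in \<open>eventually_elim, simp add: minus_divide_left\<close>)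
  qed
  have q3i: "((\<lambda>\<epsilon>. inverse (q3 \<epsilon>)) \<longlongrightarrow> exp (- \<tau>)) ?F"
    by (rule tendsto_eventually) (use q3 in \<open>eventually_elim, simp add: exp_minus\<close>)

  have same: "unit_expansion ?F
      (\<lambda>\<epsilon>. (q2 \<epsilon> * x i \<epsilon> - x j \<epsilon>) / (inverse (q2 \<epsilon>) * x i \<epsilon> - x j \<epsilon>))
      (- 2 * X i / (1 * X i - X j))" if "j \<in> {1..N} - {i}" for j
    using that i inj
    by (intro unit_expansion_ratio q22 tendsto_of_difference_quotient[OF q2i] x)
      (auto dest: inj_onD)
  have other: "unit_expansion ?F
      (\<lambda>\<epsilon>. ((q1 \<epsilon> * x i \<epsilon> - y k \<epsilon>) * (q3 \<epsilon> * x i \<epsilon> - y k \<epsilon>)) /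
        ((inverse (q1 \<epsilon>) * x i \<epsilon> - y k \<epsilon>) * (inverse (q3 \<epsilon>) * x i \<epsilon> - y k \<epsilon>)))
      (X i / (X i - exp \<tau> * Y k) + X i / (X i - exp (- \<tau>) * Y k))" if k: "k \<in> {1..M}" for k
  proof -
    have ne: "exp (- \<tau>) * X i \<noteq> Y k" "exp \<tau> * X i \<noteq> Y k"
      using XY[OF k] by (auto simp: exp_minus field_simps)
    have "unit_expansion ?F
      (\<lambda>\<epsilon>. (q1 \<epsilon> * x i \<epsilon> - y k \<epsilon>) / (inverse (q3 \<epsilon>) * x i \<epsilon> - y k \<epsilon>)
        * ((q3 \<epsilon> * x i \<epsilon> - y k \<epsilon>) / (inverse (q1 \<epsilon>) * x i \<epsilon> - y k \<epsilon>)))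
      (exp (- \<tau>) * X i / (exp (- \<tau>) * X i - Y k) + exp \<tau> * X i / (exp \<tau> * X i - Y k))"
      using k i ne
      by (intro unit_expansion_mult unit_expansion_ratio q13 q31 q3i
          tendsto_of_difference_quotient[OF q1i] x y)
    moreover have "exp (- \<tau>) * X i / (exp (- \<tau>) * X i - Y k) = X i / (X i - exp \<tau> * Y k)"
      using ne XY[OF k] by (simp add: exp_minus divide_simps)
    moreover have "exp \<tau> * X i / (exp \<tau> * X i - Y k) = X i / (X i - exp (- \<tau>) * Y k)"
      using ne XY[OF k] by (simp add: exp_minus divide_simps)
    ultimately show ?thesis
      by (simp add: times_divide_times_eq mult.commute)
  qed

  define R where "R \<epsilon> =
      (\<Prod>j\<in>{1..N} - {i}. (q2 \<epsilon> * x i \<epsilon> - x j \<epsilon>) / (inverse (q2 \<epsilon>) * x i \<epsilon> - x j \<epsilon>))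
      * (\<Prod>k=1..M. ((q1 \<epsilon> * x i \<epsilon> - y k \<epsilon>) * (q3 \<epsilon> * x i \<epsilon> - y k \<epsilon>)) /
        ((inverse (q1 \<epsilon>) * x i \<epsilon> - y k \<epsilon>) * (inverse (q3 \<epsilon>) * x i \<epsilon> - y k \<epsilon>)))" for \<epsilon>
  define C where "C = (\<Sum>j\<in>{1..N} - {i}. - 2 * X i / (1 * X i - X j))
      + (\<Sum>k=1..M. X i / (X i - exp \<tau> * Y k) + X i / (X i - exp (- \<tau>) * Y k))"
  have "unit_expansion ?F R C"
    unfolding R_def C_def by (intro unit_expansion_mult unit_expansion_prod same other)
  then have "unit_expansion ?F (\<lambda>\<epsilon>. P \<epsilon> * q2 \<epsilon> * R \<epsilon>) (c + - 1 + C)"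
    using q2 by (intro unit_expansion_mult P) (simp_all add: unit_expansion_def)
  moreover have "\<forall>\<^sub>F \<epsilon> in ?F. P \<epsilon> * q2 \<epsilon> * R \<epsilon> = 1"
  proof -
    \<comment> \<open>Cancelling the diagonal factor to \<open>- q2\<close> requires \<open>q2 \<noteq> 1\<close>, which holds because the
      first-order coefficient of \<open>q2\<close> is nonzero.\<close>
    have "\<forall>\<^sub>F \<epsilon> in ?F. (q2 \<epsilon> - 1) / \<epsilon> \<noteq> 0"
      by (rule tendsto_imp_eventually_ne[OF q2]) simp
    moreover have "\<forall>\<^sub>F \<epsilon> in ?F. q2 \<epsilon> \<noteq> 0"
      by (rule tendsto_imp_eventually_ne[OF tendsto_of_difference_quotient[OF q2]]) simp
    moreover have "\<forall>\<^sub>F \<epsilon> in ?F. x i \<epsilon> \<noteq> 0"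
      using tendsto_imp_eventually_ne[OF x[OF i] nz] .
    ultimately show ?thesis
      using eq
    proof eventually_elim
      case (elim \<epsilon>)
      have "(q2 \<epsilon> * x i \<epsilon> - x i \<epsilon>) / (inverse (q2 \<epsilon>) * x i \<epsilon> - x i \<epsilon>) =
          (q2 \<epsilon> - 1) / (inverse (q2 \<epsilon>) - 1)"
        using mult_divide_mult_cancel_right[OF elim(3), of "q2 \<epsilon> - 1" "inverse (q2 \<epsilon>) - 1"]
        by (simp add: left_diff_distrib)
      also have "\<dots> = - q2 \<epsilon>"
      proof -
        have "q2 \<epsilon> \<noteq> 1"
          using elim(1) by auto
        then show ?thesis
          using elim(2) by (simp add: field_simps)
      qed
      finally have "P \<epsilon> * (- q2 \<epsilon>) * R \<epsilon> = - 1"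
        using elim(4) i by (simp add: prod.remove[of _ i] R_def mult.assoc)
      then show ?case by simp
    qed
  qed
  moreover have "?F \<noteq> bot"
    using \<open>0 islimpt E\<close> trivial_limit_within by blast
  ultimately have "c + - 1 + C = 0"
    by (rule unit_expansion_eq_one)
  moreover have "C = X i * (- (\<Sum>j\<in>{1..N} - {i}. 2 / (X i - X j))
      + (\<Sum>k=1..M. 1 / (X i - exp \<tau> * Y k) + 1 / (X i - exp (- \<tau>) * Y k)))"
    by (simp add: C_def ring_distribs sum_distrib_left sum_negf mult.commute)
  ultimately show ?thesis
    using nz by (simp add: field_simps)
qed

theorem lemma7p2:
  fixes E :: "complex set"
    and q1 q2 q3 p0 p1 :: "complex \<Rightarrow> complex"
    and \<tau> r \<pi>' v :: complex
    and N0 N1 :: nat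
    and s t :: "nat \<Rightarrow> complex \<Rightarrow> complex"
    and s_lim t_lim :: "nat \<Rightarrow> complex"
  assumes "0 islimpt E"
    and "ILW_parameters E q1 q2 q3 p0 p1 \<tau> r \<pi>'"
    and "\<forall>\<^sub>F \<epsilon> in at 0 within E.
           toroidal_gl2_bethe (q1 \<epsilon>) (q2 \<epsilon>) (q3 \<epsilon>) (p0 \<epsilon>) (p1 \<epsilon>) v N0 N1
             (\<lambda>i. s i \<epsilon>) (\<lambda>j. t j \<epsilon>)"
    and "\<And>i. i \<in> {1..N0} \<Longrightarrow> (s i \<longlongrightarrow> s_lim i) (at 0 within E)"
    and "\<And>j. j \<in> {1..N1} \<Longrightarrow> (t j \<longlongrightarrow> t_lim j) (at 0 within E)"
    and "ILW_nondegenerate \<tau> v N0 N1 s_lim t_lim"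
  shows "ILW_bethe \<tau> r \<pi>' v N0 N1 s_lim t_lim"
proof -
  let ?F = "at 0 within E :: complex filter"
  note par = assms(2)[unfolded ILW_parameters_def]
  note nondeg = assms(6)[unfolded ILW_nondegenerate_def]
  have q1: "((\<lambda>\<epsilon>. (q1 \<epsilon> - exp (- \<tau>)) / \<epsilon>) \<longlongrightarrow> exp (- \<tau>)) ?F"
    using par by (intro tendsto_difference_quotient_of_smallo) (simp add: ring_distribs)
  have q2: "((\<lambda>\<epsilon>. (q2 \<epsilon> - 1) / \<epsilon>) \<longlongrightarrow> - 1) ?F"
    using par by (intro tendsto_difference_quotient_of_smallo) simp
  have q3: "\<forall>\<^sub>F \<epsilon> in ?F. q3 \<epsilon> = exp \<tau>"
    using par by blast
  have p1: "((\<lambda>\<epsilon>. (p1 \<epsilon> - 1) / \<epsilon>) \<longlongrightarrow> \<pi>') ?F"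
    using par by (intro tendsto_difference_quotient_of_smallo) simp
  have p01: "((\<lambda>\<epsilon>. (p0 \<epsilon> * p1 \<epsilon> - 1) / \<epsilon>) \<longlongrightarrow> r) ?F"
    using par by (intro tendsto_difference_quotient_of_smallo) simp
  have q2i: "((\<lambda>\<epsilon>. (inverse (q2 \<epsilon>) - 1) / \<epsilon>) \<longlongrightarrow> 1) ?F"
    using difference_quotient_inverse[OF q2] by simp
  have p0: "unit_expansion ?F p0 (r + - \<pi>')"
  proof -
    have "unit_expansion ?F (\<lambda>\<epsilon>. p0 \<epsilon> * p1 \<epsilon> * inverse (p1 \<epsilon>)) (r + - \<pi>')"
      using p01 difference_quotient_inverse[OF p1]
      by (intro unit_expansion_mult) (simp_all add: unit_expansion_def)
    moreover have "\<forall>\<^sub>F \<epsilon> in ?F. p1 \<epsilon> \<noteq> 0"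
      using tendsto_imp_eventually_ne[OF tendsto_of_difference_quotient[OF p1]] by simp
    then have "\<forall>\<^sub>F \<epsilon> in ?F. (p0 \<epsilon> * p1 \<epsilon> * inverse (p1 \<epsilon>) - 1) / \<epsilon> = (p0 \<epsilon> - 1) / \<epsilon>"
      by eventually_elim simp
    ultimately show ?thesis
      unfolding unit_expansion_def by (simp add: tendsto_cong)
  qed

  have "(r - \<pi>' - 2) / s_lim i + 1 / (s_lim i - v)
      - (\<Sum>k\<in>{1..N0} - {i}. 2 / (s_lim i - s_lim k))
      + (\<Sum>k=1..N1. 1 / (s_lim i - exp \<tau> * t_lim k) + 1 / (s_lim i - exp (- \<tau>) * t_lim k)) = 0"
    if i: "i \<in> {1..N0}" for i
  proof -
    have ne: "s_lim i \<noteq> 0" "s_lim i \<noteq> v"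
      using nondeg i by auto
    \<comment> \<open>The vacuum factor is an instance of the same ratio, with the fixed \<open>v\<close> in the role of
      the multiplied variable and both signs reversed.\<close>
    have vac: "unit_expansion ?F (\<lambda>\<epsilon>. (1 * v - s i \<epsilon>) / (inverse (q2 \<epsilon>) * v - s i \<epsilon>))
        (- 1 * v / (1 * v - s_lim i))"
      using ne i tendsto_minus[OF q2i]
      by (intro unit_expansion_ratio tendsto_of_difference_quotient[OF q2i] assms(4) tendsto_const)
        (simp_all add: minus_divide_left)
    have "((r + - \<pi>' + - 1 * v / (1 * v - s_lim i)) - 1) / s_lim i
        - (\<Sum>k\<in>{1..N0} - {i}. 2 / (s_lim i - s_lim k))
        + (\<Sum>k=1..N1. 1 / (s_lim i - exp \<tau> * t_lim k) + 1 / (s_lim i - exp (- \<tau>) * t_lim k)) = 0"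
    proof (rule bethe_equation_limit[OF assms(1) q1 q2 q3 unit_expansion_mult[OF p0 vac]
          assms(4) assms(5) i])
      show "\<forall>\<^sub>F \<epsilon> in ?F.
        p0 \<epsilon> * ((1 * v - s i \<epsilon>) / (inverse (q2 \<epsilon>) * v - s i \<epsilon>))
          * (\<Prod>j=1..N0. (q2 \<epsilon> * s i \<epsilon> - s j \<epsilon>) / (inverse (q2 \<epsilon>) * s i \<epsilon> - s j \<epsilon>))
          * (\<Prod>k=1..N1. ((q1 \<epsilon> * s i \<epsilon> - t k \<epsilon>) * (q3 \<epsilon> * s i \<epsilon> - t k \<epsilon>)) /
              ((inverse (q1 \<epsilon>) * s i \<epsilon> - t k \<epsilon>) * (inverse (q3 \<epsilon>) * s i \<epsilon> - t k \<epsilon>))) = -1"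
        using assms(3)
      proof eventually_elim
        case (elim \<epsilon>)
        have "(1 * v - s i \<epsilon>) / (inverse (q2 \<epsilon>) * v - s i \<epsilon>) =
            (s i \<epsilon> - v) / (s i \<epsilon> - inverse (q2 \<epsilon>) * v)"
          using minus_divide_divide[of "s i \<epsilon> - v" "s i \<epsilon> - inverse (q2 \<epsilon>) * v"] by simp
        with elim i show ?case
          unfolding toroidal_gl2_bethe_def by simp
      qed
    qed (use nondeg i in auto)
    moreover have "((r + - \<pi>' + - 1 * v / (1 * v - s_lim i)) - 1) / s_lim i =
        (r - \<pi>' - 2) / s_lim i + 1 / (s_lim i - v)"
      using ne by (simp add: divide_simps) (simp add: algebra_simps)
    ultimately show ?thesis by simp
  qed
  moreover have "(\<pi>' - 1) / t_lim j
      - (\<Sum>k\<in>{1..N1} - {j}. 2 / (t_lim j - t_lim k))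
      + (\<Sum>k=1..N0. 1 / (t_lim j - exp \<tau> * s_lim k) + 1 / (t_lim j - exp (- \<tau>) * s_lim k)) = 0"
    if j: "j \<in> {1..N1}" for j
  proof (rule bethe_equation_limit[OF assms(1) q1 q2 q3 p1[folded unit_expansion_def]
        assms(5) assms(4) j])
    show "t_lim j \<noteq> exp \<tau> * s_lim k \<and> t_lim j \<noteq> exp (- \<tau>) * s_lim k" if "k \<in> {1..N0}" for k
    proof -
      have "s_lim k \<noteq> exp \<tau> * t_lim j" "s_lim k \<noteq> exp (- \<tau>) * t_lim j"
        using nondeg that j by blast+
      then show ?thesis
        by (auto simp: exp_minus)
    qed
    show "\<forall>\<^sub>F \<epsilon> in ?F.
        p1 \<epsilon> * (\<Prod>k=1..N1. (q2 \<epsilon> * t j \<epsilon> - t k \<epsilon>) / (inverse (q2 \<epsilon>) * t j \<epsilon> - t k \<epsilon>))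
          * (\<Prod>k=1..N0. ((q1 \<epsilon> * t j \<epsilon> - s k \<epsilon>) * (q3 \<epsilon> * t j \<epsilon> - s k \<epsilon>)) /
              ((inverse (q1 \<epsilon>) * t j \<epsilon> - s k \<epsilon>) * (inverse (q3 \<epsilon>) * t j \<epsilon> - s k \<epsilon>))) = -1"
      using assms(3) by eventually_elim (use j in \<open>auto simp: toroidal_gl2_bethe_def\<close>)
  qed (use nondeg j in auto)
  ultimately show ?thesis
    unfolding ILW_bethe_def by blast
qed

end
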